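(* Let $n\geq 1$ be a natural number. There is no conjugation $C$ on $L^2(\mathbb{T})$ for which $M_{z^n}$ is $C$-symmetric and $C(H^2)\subset H^2$.
   Context: $\mathbb{T}$ is the unit circle with normalized Lebesgue measure; $H^2\subset L^2(\mathbb{T})$ is the Hardy space (functions whose negative Fourier coefficients vanish). For $\phi\in L^\infty(\mathbb{T})$, $M_\phi f=\phi f$ on $L^2(\mathbb{T})$. A conjugation on a Hilbert space $\mathcal{H}$ is an antilinear map $C:\mathcal{H}\to\mathcal{H}$ with $C^2=I$ and $\langle Cf,Cg\rangle=\langle g,f\rangle$ for all $f,g$. A bounded linear operator $T$ is $C$-symmetric if $CTC=T^*$. *)

theory Defs
  imports "HOL-Probability.Probability_Measure"
begin

text \<open>The inner product is linear in its first argument. Completeness plays no role in the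
  notions below; the only instance used is the Hilbert space of square-integrable functions
  on the circle.\<close>

class complex_inner_space = ab_group_add +
  fixes cscale :: "complex \<Rightarrow> 'a \<Rightarrow> 'a"  (infixr "*\<^sub>C" 75)
    and cinner :: "'a \<Rightarrow> 'a \<Rightarrow> complex"
  assumes cscale_add_right: "a *\<^sub>C (x + y) = a *\<^sub>C x + a *\<^sub>C y"
    and cscale_add_left: "(a + b) *\<^sub>C x = a *\<^sub>C x + b *\<^sub>C x"
    and cscale_cscale: "a *\<^sub>C (b *\<^sub>C x) = (a * b) *\<^sub>C x"
    and cscale_one: "1 *\<^sub>C x = x"
    and cinner_add_left: "cinner (x + y) z = cinner x z + cinner y z"
    and cinner_scale_left: "cinner (a *\<^sub>C x) y = a * cinner x y"
    and cinner_commute: "cinner y x = cnj (cinner x y)"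
    and cinner_ge_zero: "0 \<le> Re (cinner x x)"
    and cinner_eq_zero: "cinner x x = 0 \<Longrightarrow> x = 0"

definition cnorm :: "'a::complex_inner_space \<Rightarrow> real" where
  "cnorm x = sqrt (Re (cinner x x))"

definition bounded_clinear_op :: "('a::complex_inner_space \<Rightarrow> 'a) \<Rightarrow> bool" where
  "bounded_clinear_op T \<longleftrightarrow>
     (\<forall>x y. T (x + y) = T x + T y) \<and> (\<forall>a x. T (a *\<^sub>C x) = a *\<^sub>C T x) \<and>
     (\<exists>K. \<forall>x. cnorm (T x) \<le> K * cnorm x)"

definition cadjoint :: "('a::complex_inner_space \<Rightarrow> 'a) \<Rightarrow> 'a \<Rightarrow> 'a" where
  "cadjoint T = (THE S. \<forall>x y. cinner (T x) y = cinner x (S y))"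

definition antilinear :: "('a::complex_inner_space \<Rightarrow> 'a) \<Rightarrow> bool" where
  "antilinear C \<longleftrightarrow>
     (\<forall>x y. C (x + y) = C x + C y) \<and> (\<forall>a x. C (a *\<^sub>C x) = cnj a *\<^sub>C C x)"

definition conjugation :: "('a::complex_inner_space \<Rightarrow> 'a) \<Rightarrow> bool" where
  "conjugation C \<longleftrightarrow>
     antilinear C \<and> C \<circ> C = id \<and> (\<forall>x y. cinner (C x) (C y) = cinner y x)"

definition c_symmetric ::
    "('a::complex_inner_space \<Rightarrow> 'a) \<Rightarrow> ('a \<Rightarrow> 'a) \<Rightarrow> bool" where
  "c_symmetric C T \<longleftrightarrow> bounded_clinear_op T \<and> C \<circ> T \<circ> C = cadjoint T"

lemma cinner_add_right: "cinner x (y + z) = cinner x y + cinner x z"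
  by (metis cinner_add_left cinner_commute complex_cnj_add)

lemma cinner_diff_right: "cinner x (y - z) = cinner x y - cinner x z"
  by (metis add_diff_cancel_right' cinner_add_right diff_add_cancel)

lemma cadjoint_eqI:
  fixes T S :: "'a::complex_inner_space \<Rightarrow> 'a"
  assumes "\<And>x y. cinner (T x) y = cinner x (S y)"
  shows "cadjoint T = S"
  unfolding cadjoint_def
proof (rule the_equality)
  fix S' assume S': "\<forall>x y. cinner (T x) y = cinner x (S' y)"
  have "S' y = S y" for y
  proof -
    have "cinner x (S' y) = cinner x (S y)" for x
      using S' assms by metis
    then have "cinner (S' y - S y) (S' y - S y) = 0"
      by (metis cinner_diff_right right_minus_eq)
    from cinner_eq_zero[OF this] show ?thesis
      by simp
  qed
  then show "S' = S" by blast
qed (use assms in blast)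

text \<open>Normalized arc length on the Borel sets of the unit circle. Every Lebesgue measurable
  function agrees almost everywhere with a Borel function, so using Borel functions does not
  change the spaces of classes defined below.\<close>

definition circle :: "complex measure" where
  "circle = distr (uniform_measure lborel {0..<2 * pi}) (restrict_space borel (sphere 0 1)) cis"

definition square_integrable :: "(complex \<Rightarrow> complex) \<Rightarrow> bool" where
  "square_integrable f \<longleftrightarrow>
     f \<in> borel_measurable circle \<and> integrable circle (\<lambda>z. (norm (f z))\<^sup>2)"

definition ess_bounded :: "(complex \<Rightarrow> complex) \<Rightarrow> bool" where
  "ess_bounded \<phi> \<longleftrightarrow>
     \<phi> \<in> borel_measurable circle \<and> (\<exists>B. AE z in circle. norm (\<phi> z) \<le> B)"

definition L2_rel :: "(complex \<Rightarrow> complex) \<Rightarrow> (complex \<Rightarrow> complex) \<Rightarrow> bool" where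
  "L2_rel f g \<longleftrightarrow> square_integrable f \<and> square_integrable g \<and> (AE z in circle. f z = g z)"

lemma space_circle [simp]: "space circle = sphere 0 1"
  by (simp add: circle_def space_restrict_space)

lemma sets_circle [measurable_cong]: "sets circle = sets (restrict_space borel (sphere 0 1))"
  by (simp add: circle_def)

lemma cis_measurable_circle:
  "cis \<in> uniform_measure lborel {0..<2 * pi} \<rightarrow>\<^sub>M restrict_space borel (sphere 0 1)"
proof (rule measurable_restrict_space2)
  have "cis \<in> borel_measurable borel"
    by (intro borel_measurable_continuous_onI continuous_on_cis continuous_on_id)
  then show "cis \<in> borel_measurable (uniform_measure lborel {0..<2 * pi})"
    by (simp add: measurable_def)
qed auto

lemma prob_space_circle: "prob_space circle"
  unfolding circle_def
  by (intro prob_space.prob_space_distr prob_space_uniform_measure cis_measurable_circle) auto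

lemma borel_measurable_cnj [measurable (raw)]:
  "f \<in> borel_measurable M \<Longrightarrow> (\<lambda>x. cnj (f x)) \<in> borel_measurable M"
  by (rule borel_measurable_continuous_on[OF continuous_on_cnj[OF continuous_on_id]])

lemma square_integrable_0: "square_integrable (\<lambda>z. 0)"
  by (simp add: square_integrable_def)

lemma square_integrable_mult_bounded:
  assumes "ess_bounded \<phi>" "square_integrable f"
  shows "square_integrable (\<lambda>z. \<phi> z * f z)"
proof -
  obtain B where B: "AE z in circle. norm (\<phi> z) \<le> B"
    and [measurable]: "\<phi> \<in> borel_measurable circle"
    using assms(1) by (auto simp: ess_bounded_def)
  have [measurable]: "f \<in> borel_measurable circle"
    and int: "integrable circle (\<lambda>z. (norm (f z))\<^sup>2)"
    using assms(2) by (auto simp: square_integrable_def)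
  have "integrable circle (\<lambda>z. (norm (\<phi> z * f z))\<^sup>2)"
  proof (rule Bochner_Integration.integrable_bound)
    show "integrable circle (\<lambda>z. B\<^sup>2 * (norm (f z))\<^sup>2)"
      using int by simp
    show "AE z in circle. norm ((norm (\<phi> z * f z))\<^sup>2) \<le> norm (B\<^sup>2 * (norm (f z))\<^sup>2)"
      using B by eventually_elim (auto simp: norm_mult power_mult_distrib intro!: mult_right_mono power_mono)
  qed measurable
  then show ?thesis
    by (simp add: square_integrable_def)
qed

lemma square_integrable_scale:
  "square_integrable f \<Longrightarrow> square_integrable (\<lambda>z. a * f z)"
  by (rule square_integrable_mult_bounded[where \<phi> = \<open>\<lambda>z. a\<close>]) (auto simp: ess_bounded_def)

lemma square_integrable_uminus:
  "square_integrable f \<Longrightarrow> square_integrable (\<lambda>z. - f z)"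
  by (simp add: square_integrable_def)

lemma square_integrable_add:
  assumes "square_integrable f" "square_integrable g"
  shows "square_integrable (\<lambda>z. f z + g z)"
proof -
  have [measurable]: "f \<in> borel_measurable circle" "g \<in> borel_measurable circle"
    and int: "integrable circle (\<lambda>z. (norm (f z))\<^sup>2)" "integrable circle (\<lambda>z. (norm (g z))\<^sup>2)"
    using assms by (auto simp: square_integrable_def)
  have le: "(norm (f z + g z))\<^sup>2 \<le> 2 * (norm (f z))\<^sup>2 + 2 * (norm (g z))\<^sup>2" for z
  proof -
    have "(norm (f z + g z))\<^sup>2 \<le> (norm (f z) + norm (g z))\<^sup>2"
      by (intro power_mono norm_triangle_ineq) simp
    also have "\<dots> \<le> 2 * (norm (f z))\<^sup>2 + 2 * (norm (g z))\<^sup>2"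
      using sum_squares_bound[of "norm (f z)" "norm (g z)"] unfolding power2_sum by linarith
    finally show ?thesis .
  qed
  have "integrable circle (\<lambda>z. (norm (f z + g z))\<^sup>2)"
  proof (rule Bochner_Integration.integrable_bound)
    show "integrable circle (\<lambda>z. 2 * (norm (f z))\<^sup>2 + 2 * (norm (g z))\<^sup>2)"
      using int by simp
    show "AE z in circle. norm ((norm (f z + g z))\<^sup>2)
        \<le> norm (2 * (norm (f z))\<^sup>2 + 2 * (norm (g z))\<^sup>2)"
    proof (rule AE_I2)
      fix z
      show "norm ((norm (f z + g z))\<^sup>2) \<le> norm (2 * (norm (f z))\<^sup>2 + 2 * (norm (g z))\<^sup>2)"
        using le[of z] by simp
    qed
  qed measurable
  then show ?thesis
    by (simp add: square_integrable_def)
qed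

lemma square_integrable_inner:
  assumes "square_integrable f" "square_integrable g"
  shows "integrable circle (\<lambda>z. f z * cnj (g z))"
proof -
  have [measurable]: "f \<in> borel_measurable circle" "g \<in> borel_measurable circle"
    and int: "integrable circle (\<lambda>z. (norm (f z))\<^sup>2)" "integrable circle (\<lambda>z. (norm (g z))\<^sup>2)"
    using assms by (auto simp: square_integrable_def)
  have le: "norm (f z * cnj (g z)) \<le> (norm (f z))\<^sup>2 + (norm (g z))\<^sup>2" for z
  proof -
    have "0 \<le> norm (f z) * norm (g z)"
      by simp
    then show ?thesis
      using sum_squares_bound[of "norm (f z)" "norm (g z)"]
      unfolding norm_mult complex_mod_cnj by linarith
  qed
  show ?thesis
  proof (rule Bochner_Integration.integrable_bound)
    show "integrable circle (\<lambda>z. (norm (f z))\<^sup>2 + (norm (g z))\<^sup>2)"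
      using int by simp
    show "AE z in circle. norm (f z * cnj (g z)) \<le> norm ((norm (f z))\<^sup>2 + (norm (g z))\<^sup>2)"
    proof (rule AE_I2)
      fix z
      show "norm (f z * cnj (g z)) \<le> norm ((norm (f z))\<^sup>2 + (norm (g z))\<^sup>2)"
        using le[of z] by simp
    qed
  qed measurable
qed

quotient_type L2_circle = "complex \<Rightarrow> complex" / partial: L2_rel
proof (rule part_equivpI)
  show "\<exists>f. L2_rel f f"
    using square_integrable_0 by (auto simp: L2_rel_def)
  show "symp L2_rel"
    by (auto simp: symp_def L2_rel_def)
  show "transp L2_rel"
    by (auto simp: transp_def L2_rel_def)
qed

instantiation L2_circle :: complex_inner_space
begin

lift_definition zero_L2_circle :: L2_circle is "\<lambda>z. 0"
  by (simp add: L2_rel_def square_integrable_0)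

lift_definition plus_L2_circle :: "L2_circle \<Rightarrow> L2_circle \<Rightarrow> L2_circle"
  is "\<lambda>f g z. f z + g z"
  by (auto simp: L2_rel_def square_integrable_add)

lift_definition uminus_L2_circle :: "L2_circle \<Rightarrow> L2_circle" is "\<lambda>f z. - f z"
  by (auto simp: L2_rel_def square_integrable_uminus)

definition minus_L2_circle :: "L2_circle \<Rightarrow> L2_circle \<Rightarrow> L2_circle" where
  "minus_L2_circle f g = f + - g"

lift_definition cscale_L2_circle :: "complex \<Rightarrow> L2_circle \<Rightarrow> L2_circle"
  is "\<lambda>a f z. a * f z"
  by (auto simp: L2_rel_def square_integrable_scale)

lift_definition cinner_L2_circle :: "L2_circle \<Rightarrow> L2_circle \<Rightarrow> complex"
  is "\<lambda>f g. LINT z|circle. f z * cnj (g z)"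
  by (intro integral_cong_AE)
    (auto simp: L2_rel_def square_integrable_def
      intro!: borel_measurable_times borel_measurable_cnj)

instance
proof
  fix f g h :: L2_circle and a b :: complex
  show "f + g + h = f + (g + h)"
    by transfer (auto simp: L2_rel_def square_integrable_add add.assoc)
  show "f + g = g + f"
    by transfer (auto simp: L2_rel_def square_integrable_add add.commute)
  show "0 + f = f"
    by transfer (auto simp: L2_rel_def)
  show "- f + f = 0"
    by transfer (auto simp: L2_rel_def square_integrable_0)
  show "f - g = f + - g"
    by (simp add: minus_L2_circle_def)
  show "a *\<^sub>C (f + g) = a *\<^sub>C f + a *\<^sub>C g"
    by transfer (auto simp: L2_rel_def distrib_left intro!: square_integrable_add square_integrable_scale)
  show "(a + b) *\<^sub>C f = a *\<^sub>C f + b *\<^sub>C f"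
    by transfer (auto simp: L2_rel_def distrib_right intro!: square_integrable_add square_integrable_scale)
  show "a *\<^sub>C b *\<^sub>C f = (a * b) *\<^sub>C f"
    by transfer (auto simp: L2_rel_def mult.assoc intro!: square_integrable_scale)
  show "1 *\<^sub>C f = f"
    by transfer (auto simp: L2_rel_def)
  show "cinner (f + g) h = cinner f h + cinner g h"
    by transfer (auto simp: L2_rel_def distrib_right square_integrable_inner)
  show "cinner (a *\<^sub>C f) g = a * cinner f g"
    by transfer (auto simp: L2_rel_def mult.assoc square_integrable_inner)
  show "cinner g f = cnj (cinner f g)"
  proof transfer
    fix f g :: "complex \<Rightarrow> complex"
    have "cnj (LINT z|circle. f z * cnj (g z)) = (LINT z|circle. cnj (f z * cnj (g z)))"
      by (rule Bochner_Integration.integral_cnj[symmetric])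
    also have "(\<lambda>z. cnj (f z * cnj (g z))) = (\<lambda>z. g z * cnj (f z))"
      by (simp add: fun_eq_iff)
    finally show "(LINT z|circle. g z * cnj (f z)) = cnj (LINT z|circle. f z * cnj (g z))"
      by (rule sym)
  qed
  show "0 \<le> Re (cinner f f)"
    by transfer (auto simp: complex_norm_square[symmetric] simp flip: of_real_power)
  show "f = 0" if "cinner f f = 0"
    using that
  proof transfer
    fix f assume f: "L2_rel f f" and "(LINT z|circle. f z * cnj (f z)) = 0"
    then have "(LINT z|circle. (norm (f z))\<^sup>2) = 0"
      by (simp add: complex_norm_square[symmetric] del: of_real_power)
    then have "AE z in circle. (norm (f z))\<^sup>2 = 0"
      using f by (subst (asm) integral_nonneg_eq_0_iff_AE) (auto simp: L2_rel_def square_integrable_def)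
    then show "L2_rel f (\<lambda>z. 0)"
      using f by (auto simp: L2_rel_def square_integrable_0)
  qed
qed

end

text \<open>Multiplication by \<open>\<phi>\<close> is meaningful only for \<open>\<phi>\<close> in \<open>L\<^sup>\<infinity>\<close>; for other \<open>\<phi>\<close> it is set to 0.\<close>

lift_definition mult_op :: "(complex \<Rightarrow> complex) \<Rightarrow> L2_circle \<Rightarrow> L2_circle"
  is "\<lambda>\<phi> f. if ess_bounded \<phi> then (\<lambda>z. \<phi> z * f z) else (\<lambda>z. 0)"
  by (auto simp: L2_rel_def square_integrable_0 square_integrable_mult_bounded)

lemma ess_bounded_power: "ess_bounded (\<lambda>z. z ^ n)"
proof -
  have "norm (z ^ n) \<le> 1" if "z \<in> space circle" for z :: complex
    using that by (simp add: norm_power)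
  moreover have "(\<lambda>z. z ^ n) \<in> borel_measurable circle"
    unfolding measurable_cong_sets[OF sets_circle refl]
    by (intro measurable_restrict_space1) measurable
  ultimately show ?thesis
    unfolding ess_bounded_def by (blast intro: AE_I2)
qed

lemma ess_bounded_cnj: "ess_bounded \<phi> \<Longrightarrow> ess_bounded (\<lambda>z. cnj (\<phi> z))"
  by (auto simp: ess_bounded_def intro: borel_measurable_cnj)

lemma bounded_clinear_op_mult_op:
  assumes "ess_bounded \<phi>"
  shows "bounded_clinear_op (mult_op \<phi>)"
proof -
  obtain B where B: "AE z in circle. norm (\<phi> z) \<le> B"
    using assms by (auto simp: ess_bounded_def)
  have "Re (cinner (mult_op \<phi> f) (mult_op \<phi> f)) \<le> B\<^sup>2 * Re (cinner f f)" for f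
    using assms B
  proof (transfer fixing: \<phi> B)
    fix f assume f: "L2_rel f f"
    then have sq: "square_integrable (\<lambda>z. \<phi> z * f z)" "square_integrable f"
      using assms by (auto simp: L2_rel_def square_integrable_mult_bounded)
    have "(LINT z|circle. (norm (\<phi> z * f z))\<^sup>2) \<le> (LINT z|circle. B\<^sup>2 * (norm (f z))\<^sup>2)"
    proof (rule integral_mono_AE)
      show "AE z in circle. (norm (\<phi> z * f z))\<^sup>2 \<le> B\<^sup>2 * (norm (f z))\<^sup>2"
        using B by eventually_elim
          (auto simp: norm_mult power_mult_distrib intro!: mult_right_mono power_mono)
    qed (use sq in \<open>auto simp: square_integrable_def\<close>)
    then show "Re (LINT z|circle. (if ess_bounded \<phi> then \<lambda>z. \<phi> z * f z else (\<lambda>z. 0)) z *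
        cnj ((if ess_bounded \<phi> then \<lambda>z. \<phi> z * f z else (\<lambda>z. 0)) z))
      \<le> B\<^sup>2 * Re (LINT z|circle. f z * cnj (f z))"
      using assms by (simp add: complex_norm_square[symmetric] del: of_real_power complex_cnj_mult)
  qed
  then have "cnorm (mult_op \<phi> f) \<le> \<bar>B\<bar> * cnorm f" for f
    unfolding cnorm_def by (metis real_sqrt_abs real_sqrt_le_mono real_sqrt_mult)
  moreover have "mult_op \<phi> (f + g) = mult_op \<phi> f + mult_op \<phi> g" for f g
    using assms
    by transfer (auto simp: L2_rel_def distrib_left
        intro!: square_integrable_add square_integrable_mult_bounded)
  moreover have "mult_op \<phi> (a *\<^sub>C f) = a *\<^sub>C mult_op \<phi> f" for a f
    using assms
    by transfer (auto simp: L2_rel_def mult.left_commute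
        intro!: square_integrable_scale square_integrable_mult_bounded)
  ultimately show ?thesis
    unfolding bounded_clinear_op_def by blast
qed

lemma cadjoint_mult_op:
  assumes "ess_bounded \<phi>"
  shows "cadjoint (mult_op \<phi>) = mult_op (\<lambda>z. cnj (\<phi> z))"
proof (rule cadjoint_eqI)
  fix f g
  have "(\<lambda>z. \<phi> z * u z * cnj (v z)) = (\<lambda>z. u z * cnj (cnj (\<phi> z) * v z))" for u v
    by (simp add: fun_eq_iff)
  then show "cinner (mult_op \<phi> f) g = cinner f (mult_op (\<lambda>z. cnj (\<phi> z)) g)"
    using assms ess_bounded_cnj[OF assms]
    apply (transfer fixing: \<phi>)
    apply (simp only: if_True)
    done
qed

lemma borel_measurable_powi_circle: "(\<lambda>z. z powi k) \<in> borel_measurable circle"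
  unfolding measurable_cong_sets[OF sets_circle refl]
  by (intro borel_measurable_continuous_on_restrict continuous_intros) auto

lift_definition fourier_coeff :: "L2_circle \<Rightarrow> int \<Rightarrow> complex"
  is "\<lambda>f k. LINT z|circle. f z * cnj (z powi k)"
  by (intro ext integral_cong_AE)
    (auto simp: L2_rel_def square_integrable_def simp del: complex_cnj_power_int
      intro!: borel_measurable_times borel_measurable_cnj borel_measurable_powi_circle)

definition hardy2 :: "L2_circle set" where
  "hardy2 = {f. \<forall>k<0. fourier_coeff f k = 0}"

end

(* C-symmetry makes the adjoint of M_{z^n}, which is multiplication by cnj z^n, equal to
   C M_{z^n} C. Both M_{z^n} and C preserve H^2, hence so does multiplication by cnj z^n.
   But it sends the constant 1 to z^(-n), which is not in H^2. *)
theory Submission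
  imports Defs
begin

text \<open>Pulls the integral back along \<open>cis\<close> to a set integral over a closed
  interval, the form in which the fundamental theorem of calculus applies.\<close>

lemma integral_circle:
  fixes f :: "complex \<Rightarrow> complex"
  assumes "f \<in> borel_measurable circle"
  shows "integral\<^sup>L circle f = (LINT t:{0..2 * pi}|lborel. f (cis t)) / (2 * pi)"
proof -
  have meas: "f \<in> borel_measurable (restrict_space borel (sphere 0 1))"
    using assms by (simp add: measurable_cong_sets[OF sets_circle refl])
  have [measurable]: "(\<lambda>t. f (cis t)) \<in> borel_measurable lborel"
    using measurable_compose[OF cis_measurable_circle meas] by (simp add: measurable_def)
  \<comment> \<open>The density is rewritten as \<open>ennreal\<close> of a real function, as
    \<open>integral_density\<close> requires.\<close>
  have dens: "uniform_measure lborel {0..<2 * pi}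
      = density lborel (\<lambda>t. ennreal (indicator {0..<2 * pi} t / (2 * pi)))"
    unfolding uniform_measure_def
    by (intro density_cong AE_I2) (auto simp: divide_ennreal[symmetric] ennreal_indicator)
  have "integral\<^sup>L circle f = (LINT t|uniform_measure lborel {0..<2 * pi}. f (cis t))"
    unfolding circle_def by (rule integral_distr[OF cis_measurable_circle meas])
  also have "\<dots> = (LINT t|lborel. (indicator {0..<2 * pi} t / (2 * pi)) *\<^sub>R f (cis t))"
    unfolding dens by (rule integral_density) auto
  \<comment> \<open>Closing the interval adds only the null set consisting of the point
    \<open>2 * pi\<close>.\<close>
  also have "\<dots> = (LINT t|lborel. (indicator {0..2 * pi} t *\<^sub>R f (cis t)) / (2 * pi))"
  proof (rule integral_cong_AE)
    show "AE t in lborel. (indicator {0..<2 * pi} t / (2 * pi)) *\<^sub>R f (cis t)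
        = (indicator {0..2 * pi} t *\<^sub>R f (cis t)) / (2 * pi)"
      using AE_lborel_singleton[of "2 * pi"]
      by eventually_elim (auto simp: scaleR_conv_of_real split: split_indicator)
  qed auto
  finally show ?thesis
    by (simp add: set_lebesgue_integral_def)
qed

text \<open>Since \<open>m\<close> is nonzero, \<open>cis t ^ m\<close> has the antiderivative
  \<open>cis t ^ m / (\<i> * m)\<close>, which takes the same value at both endpoints.\<close>

lemma integral_circle_power:
  assumes "m > 0"
  shows "(LINT z|circle. z ^ m) = 0"
proof -
  have "(LINT t:{0..2 * pi}|lborel. cis t ^ m)
      = cis (2 * pi) ^ m / (\<i> * m) - cis 0 ^ m / (\<i> * m)"
    unfolding set_lebesgue_integral_def
  proof (rule integral_FTC_Icc)
    have power_eq: "x * x ^ (m - Suc 0) = x ^ m" for x :: complex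
      using assms by (cases m) auto
    fix t :: real
    show "((\<lambda>t. cis t ^ m / (\<i> * m)) has_vector_derivative cis t ^ m) (at t within {0..2 * pi})"
      unfolding cis_conv_exp using assms
      by (auto intro!: derivative_eq_intros has_vector_derivative_real_field
          simp: field_simps power_eq)
  qed (auto intro!: continuous_intros continuous_on_cis)
  moreover have "(\<lambda>z. z ^ m) \<in> borel_measurable circle"
    using ess_bounded_power by (simp add: ess_bounded_def)
  ultimately show ?thesis
    by (simp add: integral_circle)
qed

text \<open>On the circle \<open>cnj z\<close> is the inverse of \<open>z\<close>, so the factor
  \<open>z ^ n\<close> can be absorbed into the conjugated power.\<close>

lemma fourier_coeff_mult_power:
  "fourier_coeff (mult_op (\<lambda>z. z ^ n) f) k = fourier_coeff f (k - int n)"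
  using ess_bounded_power[of n]
proof (transfer fixing: n k)
  fix f :: "complex \<Rightarrow> complex"
  assume "ess_bounded (\<lambda>z. z ^ n)"
  moreover have "z ^ n * f z * cnj (z powi k) = f z * cnj (z powi (k - int n))"
    if "z \<in> space circle" for z
  proof -
    from that have "z \<noteq> 0" "z * cnj z = 1"
      by (auto simp: complex_norm_square[symmetric])
    then show ?thesis
      by (simp add: power_int_diff field_simps flip: power_mult_distrib)
  qed
  ultimately show "(LINT z|circle. (if ess_bounded (\<lambda>z. z ^ n) then \<lambda>z. z ^ n * f z
      else (\<lambda>z. 0)) z * cnj (z powi k)) = (LINT z|circle. f z * cnj (z powi (k - int n)))"
    by (intro Bochner_Integration.integral_cong) (simp_all only: if_True)
qed

text \<open>Holds because \<open>z * cnj z = 1\<close> on the circle. Together with the shift rule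
  for \<open>z ^ n\<close> it yields the coefficients of \<open>cnj (z ^ n) * f\<close> without a
  second computation.\<close>

lemma mult_op_cnj_power_cancel:
  "mult_op (\<lambda>z. z ^ n) (mult_op (\<lambda>z. cnj (z ^ n)) f) = f"
  using ess_bounded_power[of n] ess_bounded_cnj[OF ess_bounded_power[of n]]
proof (transfer fixing: n)
  fix f :: "complex \<Rightarrow> complex"
  assume b: "ess_bounded (\<lambda>z. z ^ n)" "ess_bounded (\<lambda>z. cnj (z ^ n))" and "L2_rel f f"
  have "z ^ n * (cnj (z ^ n) * f z) = f z" if "z \<in> space circle" for z
  proof -
    from that have "z * cnj z = 1"
      by (auto simp: complex_norm_square[symmetric])
    then show ?thesis
      by (simp add: mult.assoc[symmetric] flip: power_mult_distrib)
  qed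
  with b \<open>L2_rel f f\<close> have "L2_rel (\<lambda>z. z ^ n * (cnj (z ^ n) * f z)) f"
    unfolding L2_rel_def by (intro conjI square_integrable_mult_bounded AE_I2) auto
  with b show "L2_rel (if ess_bounded (\<lambda>z. z ^ n)
      then \<lambda>z. z ^ n * (if ess_bounded (\<lambda>z. cnj (z ^ n)) then \<lambda>z. cnj (z ^ n) * f z else (\<lambda>z. 0)) z
      else (\<lambda>z. 0)) f"
    by (simp only: if_True)
qed

text \<open>The witness is the constant function 1: its coefficients of negative index are integrals
  of positive powers of \<open>z\<close>, and its mean is 1 because \<open>circle\<close> has total
  mass 1.\<close>

lemma hardy2_one:
  obtains e where "e \<in> hardy2" "fourier_coeff e 0 = 1"
proof
  interpret prob_space circle by (rule prob_space_circle)
  have "L2_rel (\<lambda>z. 1) (\<lambda>z. 1)"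
    by (simp add: L2_rel_def square_integrable_def)
  note coeff = fourier_coeff.abs_eq[OF this]
  show "fourier_coeff (abs_L2_circle (\<lambda>z. 1)) 0 = 1"
    by (simp add: coeff prob_space[unfolded space_circle])
  have "(LINT z|circle. cnj (z powi k)) = 0" if "k < 0" for k
  proof -
    have "cnj (z powi k) = z ^ nat (- k)" if "z \<in> space circle" for z
    proof -
      from that have "z * cnj z = 1"
        by (auto simp: complex_norm_square[symmetric])
      then have "inverse (cnj z) = z"
        by (metis inverse_unique mult.commute)
      with \<open>k < 0\<close> show ?thesis
        by (simp add: power_int_def flip: power_inverse)
    qed
    then have "(LINT z|circle. cnj (z powi k)) = (LINT z|circle. z ^ nat (- k))"
      by (intro Bochner_Integration.integral_cong) auto
    with that show ?thesis
      by (simp add: integral_circle_power)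
  qed
  then show "abs_L2_circle (\<lambda>z. 1) \<in> hardy2"
    by (simp add: hardy2_def coeff)
qed

theorem theorem6p3:
  fixes n :: nat
  assumes "n \<ge> 1"
  shows "\<not> (\<exists>C :: L2_circle \<Rightarrow> L2_circle.
             conjugation C \<and> c_symmetric C (mult_op (\<lambda>z. z ^ n)) \<and> C ` hardy2 \<subseteq> hardy2)"
proof
  assume "\<exists>C :: L2_circle \<Rightarrow> L2_circle.
             conjugation C \<and> c_symmetric C (mult_op (\<lambda>z. z ^ n)) \<and> C ` hardy2 \<subseteq> hardy2"
  then obtain C :: "L2_circle \<Rightarrow> L2_circle"
    where "c_symmetric C (mult_op (\<lambda>z. z ^ n))" and C: "\<And>f. f \<in> hardy2 \<Longrightarrow> C f \<in> hardy2"
    by blast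
  then have adj: "C (mult_op (\<lambda>z. z ^ n) (C f)) = mult_op (\<lambda>z. cnj (z ^ n)) f" for f
    unfolding c_symmetric_def cadjoint_mult_op[OF ess_bounded_power] by (metis comp_apply)
  obtain e where e: "e \<in> hardy2" "fourier_coeff e 0 = 1"
    by (rule hardy2_one)
  \<comment> \<open>The shift sends a negative index \<open>k\<close> to \<open>k - int n\<close>,
    which is again negative.\<close>
  have "mult_op (\<lambda>z. z ^ n) (C e) \<in> hardy2"
    using C[OF e(1)] by (simp add: hardy2_def fourier_coeff_mult_power)
  then have "mult_op (\<lambda>z. cnj (z ^ n)) e \<in> hardy2"
    using C adj by metis
  \<comment> \<open>This index is negative because \<open>n \<ge> 1\<close>; it is left unsimplified
    to match the shift rule at \<open>k = 0\<close>.\<close>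
  then have "fourier_coeff (mult_op (\<lambda>z. cnj (z ^ n)) e) (0 - int n) = 0"
    using assms by (simp add: hardy2_def)
  \<comment> \<open>Multiplying \<open>cnj (z ^ n) * e\<close> by \<open>z ^ n\<close> gives back
    \<open>e\<close> and moves the coefficient at \<open>- int n\<close> to index 0.\<close>
  then have "fourier_coeff e 0 = 0"
    by (metis fourier_coeff_mult_power mult_op_cnj_power_cancel)
  with e show False
    by simp
qed

end
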